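(* Let $K/F$ be a finite field extension, let $\sigma\in \mathrm{Aut}_F(K)$ with $\sigma\neq \mathrm{id}$, and let $c\in K^{\times}$. Then $D(K,\sigma,c)$ is a division algebra if and only if $c\neq r^2 s\,\sigma(s)^{-1}t^{-1}\sigma(t)^{-1}$ for all $r,s,t\in K^{\times}$.
   Context: $D(K,\sigma,c)$ denotes the $F$-vector space $K\oplus K$ with multiplication $(u,v)(x,y)=(ux+c\,\sigma(vy),\,uy+vx)$ for $u,v,x,y\in K$; it is a unital commutative, not necessarily associative, finite-dimensional $F$-algebra. A finite-dimensional (nonassociative) $F$-algebra $A$ is a division algebra if for every nonzero $a\in A$ the maps $x\mapsto ax$ and $x\mapsto xa$ are bijective; equivalently, $A$ has no zero divisors. The field $F$ is arbitrary. *)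

theory Defs
  imports "HOL-Algebra.Algebra"
begin

text \<open>
  Algebras here need not be associative, commutative or unital, so the ring locales do not apply to
  them. Their carrier and operations are packaged in the library record \<open>module\<close>, whose \<open>one\<close> field
  plays no role in the notion of a division algebra.
\<close>

locale nonassoc_algebra = module R A for R (structure) and A (structure) +
  assumes mult_closed:
      "\<lbrakk>x \<in> carrier A; y \<in> carrier A\<rbrakk> \<Longrightarrow> x \<otimes>\<^bsub>A\<^esub> y \<in> carrier A"
    and mult_l_distr:
      "\<lbrakk>x \<in> carrier A; y \<in> carrier A; z \<in> carrier A\<rbrakk> \<Longrightarrow>
        (x \<oplus>\<^bsub>A\<^esub> y) \<otimes>\<^bsub>A\<^esub> z = x \<otimes>\<^bsub>A\<^esub> z \<oplus>\<^bsub>A\<^esub> y \<otimes>\<^bsub>A\<^esub> z"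
    and mult_r_distr:
      "\<lbrakk>x \<in> carrier A; y \<in> carrier A; z \<in> carrier A\<rbrakk> \<Longrightarrow>
        z \<otimes>\<^bsub>A\<^esub> (x \<oplus>\<^bsub>A\<^esub> y) = z \<otimes>\<^bsub>A\<^esub> x \<oplus>\<^bsub>A\<^esub> z \<otimes>\<^bsub>A\<^esub> y"
    and smult_mult_l:
      "\<lbrakk>a \<in> carrier R; x \<in> carrier A; y \<in> carrier A\<rbrakk> \<Longrightarrow>
        (a \<odot>\<^bsub>A\<^esub> x) \<otimes>\<^bsub>A\<^esub> y = a \<odot>\<^bsub>A\<^esub> (x \<otimes>\<^bsub>A\<^esub> y)"
    and smult_mult_r:
      "\<lbrakk>a \<in> carrier R; x \<in> carrier A; y \<in> carrier A\<rbrakk> \<Longrightarrow>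
        x \<otimes>\<^bsub>A\<^esub> (a \<odot>\<^bsub>A\<^esub> y) = a \<odot>\<^bsub>A\<^esub> (x \<otimes>\<^bsub>A\<^esub> y)"

definition finitely_spanned ::
    "('f, 'm) ring_scheme \<Rightarrow> ('f, 'a, 'n) module_scheme \<Rightarrow> bool" where
  "finitely_spanned R A \<longleftrightarrow>
     (\<exists>B. finite B \<and> B \<subseteq> carrier A \<and>
        (\<forall>x\<in>carrier A. \<exists>f\<in>B \<rightarrow> carrier R. x = (\<Oplus>\<^bsub>A\<^esub>b\<in>B. f b \<odot>\<^bsub>A\<^esub> b)))"

locale division_algebra = field R + nonassoc_algebra R A for R (structure) and A (structure) +
  assumes finite_dimensional: "finitely_spanned R A"
    and left_mult_bij:
      "\<lbrakk>a \<in> carrier A; a \<noteq> \<zero>\<^bsub>A\<^esub>\<rbrakk> \<Longrightarrow> bij_betw (\<lambda>x. a \<otimes>\<^bsub>A\<^esub> x) (carrier A) (carrier A)"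
    and right_mult_bij:
      "\<lbrakk>a \<in> carrier A; a \<noteq> \<zero>\<^bsub>A\<^esub>\<rbrakk> \<Longrightarrow> bij_betw (\<lambda>x. x \<otimes>\<^bsub>A\<^esub> a) (carrier A) (carrier A)"

text \<open>
  The scalar multiplication of \<open>D(K, \<sigma>, c)\<close> is given by all of \<open>K\<close>; as an algebra over a subfield
  \<open>F\<close> it is only ever used with scalars from \<open>F\<close>. For scalars outside the fixed field of \<open>\<sigma>\<close> it is
  not compatible with the multiplication.
\<close>

definition D_algebra ::
    "('a, 'm) ring_scheme \<Rightarrow> ('a \<Rightarrow> 'a) \<Rightarrow> 'a \<Rightarrow> ('a, 'a \<times> 'a) module" where
  "D_algebra K \<sigma> c =
     \<lparr>carrier = carrier K \<times> carrier K,
      monoid.mult = (\<lambda>(u, v) (x, y).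
        (u \<otimes>\<^bsub>K\<^esub> x \<oplus>\<^bsub>K\<^esub> c \<otimes>\<^bsub>K\<^esub> \<sigma> (v \<otimes>\<^bsub>K\<^esub> y), u \<otimes>\<^bsub>K\<^esub> y \<oplus>\<^bsub>K\<^esub> v \<otimes>\<^bsub>K\<^esub> x)),
      one = (\<one>\<^bsub>K\<^esub>, \<zero>\<^bsub>K\<^esub>),
      ring.zero = (\<zero>\<^bsub>K\<^esub>, \<zero>\<^bsub>K\<^esub>),
      add = (\<lambda>(u, v) (x, y). (u \<oplus>\<^bsub>K\<^esub> x, v \<oplus>\<^bsub>K\<^esub> y)),
      smult = (\<lambda>a (u, v). (a \<otimes>\<^bsub>K\<^esub> u, a \<otimes>\<^bsub>K\<^esub> v))\<rparr>"

text \<open>\<open>Aut\<^sub>F(K)\<close>; only the values of its elements on the carrier of \<open>K\<close> matter.\<close>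

definition field_auts :: "('a, 'm) ring_scheme \<Rightarrow> 'a set \<Rightarrow> ('a \<Rightarrow> 'a) set" where
  "field_auts K F = {\<sigma> \<in> ring_iso K K. \<forall>a\<in>F. \<sigma> a = a}"

end

theory Submission
  imports Defs
begin

text \<open>
  If \<open>(u, v) (x, y) = 0\<close> with both factors nonzero, then \<open>v\<close> and \<open>y\<close> are nonzero, and eliminating
  \<open>x = - u y / v\<close> leaves \<open>c v \<sigma>(v) \<sigma>(y) = u\<^sup>2 y\<close>, which is the excluded form of \<open>c\<close> for
  \<open>(r, s, t) = (u, y, v)\<close>; the elimination is reversible. Without zero divisors, multiplication by
  \<open>(u, v)\<close> is onto: the same elimination reduces solvability of \<open>(u, v) (x, y) = (p, q)\<close> to
  surjectivity of the \<open>F\<close>-linear map \<open>y \<mapsto> c v \<sigma>(v) \<sigma>(y) - u\<^sup>2 y\<close> on \<open>K\<close>, which has trivial kernel.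
\<close>

section \<open>Linear maps over a subfield\<close>

text \<open>A linear map with trivial kernel carries a basis over \<open>F\<close> to an independent
  family of the same length, and such a family spans because its length is the dimension.\<close>

lemma (in ring) linear_inj_imp_surj:
  assumes F: "subfield F R" and fin: "finite_dimension F (carrier R)"
    and closed: "\<And>x. x \<in> carrier R \<Longrightarrow> f x \<in> carrier R"
    and add: "\<And>x y. \<lbrakk>x \<in> carrier R; y \<in> carrier R\<rbrakk> \<Longrightarrow> f (x \<oplus> y) = f x \<oplus> f y"
    and scale: "\<And>a x. \<lbrakk>a \<in> F; x \<in> carrier R\<rbrakk> \<Longrightarrow> f (a \<otimes> x) = a \<otimes> f x"
    and ker: "\<And>x. \<lbrakk>x \<in> carrier R; f x = \<zero>\<rbrakk> \<Longrightarrow> x = \<zero>"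
  shows "f ` carrier R = carrier R"
proof
  show "f ` carrier R \<subseteq> carrier R" using closed by auto
next
  have FR: "F \<subseteq> carrier R" using F by (rule subfieldE)
  have f0: "f \<zero> = \<zero>"
    using add[of \<zero> \<zero>] closed[of \<zero>] by (metis add.r_cancel_one' l_zero zero_closed)
  have combine_f: "f (combine Ks Us) = combine Ks (map f Us)"
    if "set Ks \<subseteq> F" "set Us \<subseteq> carrier R" for Ks Us
    using that
  proof (induction Ks Us rule: combine.induct)
    case (1 k Ks u Us)
    then have "k \<in> carrier R" "set Ks \<subseteq> carrier R" using FR by auto
    with 1 show ?case by (simp add: add scale)
  qed (simp_all add: f0)
  obtain n where n: "dimension n F (carrier R)" using fin by (auto simp: finite_dimension_def)
  obtain Us where Us: "set Us \<subseteq> carrier R" "independent F Us" "length Us = n"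
    using exists_base[OF F n] by blast
  have fUs: "set (map f Us) \<subseteq> carrier R" using Us(1) closed by auto
  have "independent F (map f Us)"
  proof (rule trivial_combine_imp_independent[OF F fUs])
    fix Ks assume Ks: "set Ks \<subseteq> F" "combine Ks (map f Us) = \<zero>"
    have "set Ks \<subseteq> carrier R" using Ks(1) FR by blast
    \<comment> \<open>By linearity a relation among the images is \<open>f\<close> applied to the
      same combination of \<open>Us\<close>, so the trivial kernel pulls it back to a relation among
      \<open>Us\<close>.\<close>
    then have "combine Ks Us = \<zero>"
      using ker[of "combine Ks Us"] combine_f[OF Ks(1) Us(1)] Ks(2) Us(1) by simp
    then show "set (take (length (map f Us)) Ks) \<subseteq> {\<zero>}"
      using independent_imp_trivial_combine[OF F Us(2) Ks(1)] by simp
  qed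
  then have span: "Span F (map f Us) = carrier R"
    using independent_length_eq_dimension[OF F n _ fUs] Us(3) by simp
  show "carrier R \<subseteq> f ` carrier R"
  proof
    fix x assume "x \<in> carrier R"
    then obtain Ks where Ks: "set Ks \<subseteq> F" "x = combine Ks (map f Us)"
      using span Span_eq_combine_set[OF F fUs] by auto
    moreover have "combine Ks Us \<in> carrier R" using Ks(1) FR Us(1) by auto
    ultimately show "x \<in> f ` carrier R" using combine_f[OF Ks(1) Us(1)] by (metis imageI)
  qed
qed

section \<open>Linear combinations of a finite set in a module\<close>

text \<open>This is the condition inside \<open>finitely_spanned\<close> collected into a set: a
  finite \<open>B\<close> in the carrier is a spanning set exactly when
  \<open>lin_combs R M B\<close> contains the whole carrier. Spanning can then be proved through
  closure properties instead of explicit coefficient functions.\<close>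

definition lin_combs ::
    "('f, 'm) ring_scheme \<Rightarrow> ('f, 'a, 'n) module_scheme \<Rightarrow> 'a set \<Rightarrow> 'a set" where
  "lin_combs R M B = {x. \<exists>f\<in>B \<rightarrow> carrier R. x = (\<Oplus>\<^bsub>M\<^esub>b\<in>B. f b \<odot>\<^bsub>M\<^esub> b)}"

context module
begin

context
  fixes B assumes B: "finite B" "B \<subseteq> carrier M"
begin

lemma lin_combs_add:
  assumes "x \<in> lin_combs R M B" "y \<in> lin_combs R M B"
  shows "x \<oplus>\<^bsub>M\<^esub> y \<in> lin_combs R M B"
proof -
  obtain f g where f: "f \<in> B \<rightarrow> carrier R" "x = (\<Oplus>\<^bsub>M\<^esub>b\<in>B. f b \<odot>\<^bsub>M\<^esub> b)"
    and g: "g \<in> B \<rightarrow> carrier R" "y = (\<Oplus>\<^bsub>M\<^esub>b\<in>B. g b \<odot>\<^bsub>M\<^esub> b)"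
    using assms by (auto simp: lin_combs_def)
  have "(\<Oplus>\<^bsub>M\<^esub>b\<in>B. (f b \<oplus> g b) \<odot>\<^bsub>M\<^esub> b) = (\<Oplus>\<^bsub>M\<^esub>b\<in>B. f b \<odot>\<^bsub>M\<^esub> b \<oplus>\<^bsub>M\<^esub> g b \<odot>\<^bsub>M\<^esub> b)"
    using f(1) g(1) B by (intro M.finsum_cong') (auto simp: Pi_iff subset_iff smult_l_distr)
  also have "\<dots> = x \<oplus>\<^bsub>M\<^esub> y"
    unfolding f(2) g(2) using f(1) g(1) B by (intro M.finsum_addf) (auto simp: Pi_iff subset_iff)
  finally show ?thesis
    using f(1) g(1) by (auto simp: lin_combs_def Pi_iff intro!: bexI[of _ "\<lambda>b. f b \<oplus> g b"])
qed

lemma lin_combs_smult: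
  assumes "a \<in> carrier R" "x \<in> lin_combs R M B"
  shows "a \<odot>\<^bsub>M\<^esub> x \<in> lin_combs R M B"
proof -
  obtain f where f: "f \<in> B \<rightarrow> carrier R" "x = (\<Oplus>\<^bsub>M\<^esub>b\<in>B. f b \<odot>\<^bsub>M\<^esub> b)"
    using assms by (auto simp: lin_combs_def)
  have "a \<odot>\<^bsub>M\<^esub> x = (\<Oplus>\<^bsub>M\<^esub>b\<in>B. a \<odot>\<^bsub>M\<^esub> (f b \<odot>\<^bsub>M\<^esub> b))"
    unfolding f(2) using f(1) B assms(1)
    by (intro finsum_smult_ldistr) (auto simp: Pi_iff subset_iff)
  also have "\<dots> = (\<Oplus>\<^bsub>M\<^esub>b\<in>B. (a \<otimes> f b) \<odot>\<^bsub>M\<^esub> b)"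
    using f(1) B assms(1) by (intro M.finsum_cong') (auto simp: Pi_iff subset_iff smult_assoc1)
  finally show ?thesis
    using f(1) assms(1) by (auto simp: lin_combs_def Pi_iff intro!: bexI[of _ "\<lambda>b. a \<otimes> f b"])
qed

lemma zero_in_lin_combs: "\<zero>\<^bsub>M\<^esub> \<in> lin_combs R M B"
proof -
  have "(\<Oplus>\<^bsub>M\<^esub>b\<in>B. \<zero> \<odot>\<^bsub>M\<^esub> b) = (\<Oplus>\<^bsub>M\<^esub>b\<in>B. \<zero>\<^bsub>M\<^esub>)"
    using B by (intro M.finsum_cong') (auto simp: smult_l_null)
  then show ?thesis
    by (auto simp: lin_combs_def intro!: bexI[of _ "\<lambda>b. \<zero>"])
qed

lemma in_lin_combs:
  assumes "b \<in> B" shows "b \<in> lin_combs R M B"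
proof -
  have "(\<Oplus>\<^bsub>M\<^esub>i\<in>B. (if b = i then \<one> else \<zero>) \<odot>\<^bsub>M\<^esub> i) = (\<Oplus>\<^bsub>M\<^esub>i\<in>B. if b = i then i else \<zero>\<^bsub>M\<^esub>)"
    using B by (intro M.finsum_cong') (auto simp: smult_l_null)
  also have "\<dots> = b"
    using B assms by (intro M.finsum_singleton[where f = "\<lambda>i. i"]) auto
  finally show ?thesis
    by (auto simp: lin_combs_def intro!: bexI[of _ "\<lambda>i. if b = i then \<one> else \<zero>"])
qed

end

end

section \<open>Arithmetic of K, \<sigma> and the twisted product\<close>

locale twisted_double = K?: field K for K :: "('a, 'm) ring_scheme" (structure) +
  fixes F :: "'a set" and \<sigma> :: "'a \<Rightarrow> 'a" and c :: 'a
  assumes subfield_F: "subfield F K"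
    and finite_ext: "finite_dimension F (carrier K)"
    and \<sigma>_aut: "\<sigma> \<in> field_auts K F"
    and c_closed [simp]: "c \<in> carrier K" and c_nonzero [simp]: "c \<noteq> \<zero>"
begin

abbreviation D :: "('a, 'a \<times> 'a) module" where
  "D \<equiv> D_algebra K \<sigma> c"

lemma D_simps [simp]:
  "carrier D = carrier K \<times> carrier K"
  "(u, v) \<otimes>\<^bsub>D\<^esub> (x, y) = (u \<otimes> x \<oplus> c \<otimes> \<sigma> (v \<otimes> y), u \<otimes> y \<oplus> v \<otimes> x)"
  "\<zero>\<^bsub>D\<^esub> = (\<zero>, \<zero>)"
  "(u, v) \<oplus>\<^bsub>D\<^esub> (x, y) = (u \<oplus> x, v \<oplus> y)"
  "a \<odot>\<^bsub>D\<^esub> (u, v) = (a \<otimes> u, a \<otimes> v)"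
  by (simp_all add: D_algebra_def)

lemma \<sigma>_hom: "\<sigma> \<in> ring_hom K K" and \<sigma>_bij: "bij_betw \<sigma> (carrier K) (carrier K)"
  and \<sigma>_fixes: "a \<in> F \<Longrightarrow> \<sigma> a = a"
  using \<sigma>_aut by (auto simp: field_auts_def ring_iso_def)

lemma \<sigma>_closed [simp]: "x \<in> carrier K \<Longrightarrow> \<sigma> x \<in> carrier K"
  and \<sigma>_add [simp]: "\<lbrakk>x \<in> carrier K; y \<in> carrier K\<rbrakk> \<Longrightarrow> \<sigma> (x \<oplus> y) = \<sigma> x \<oplus> \<sigma> y"
  and \<sigma>_mult [simp]: "\<lbrakk>x \<in> carrier K; y \<in> carrier K\<rbrakk> \<Longrightarrow> \<sigma> (x \<otimes> y) = \<sigma> x \<otimes> \<sigma> y"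
  using \<sigma>_hom by (auto simp: ring_hom_closed ring_hom_add ring_hom_mult)

lemma \<sigma>_zero [simp]: "\<sigma> \<zero> = \<zero>"
  by (rule ring_hom_zero[OF \<sigma>_hom ring_axioms ring_axioms])

lemma \<sigma>_eq_zero_iff [simp]: "x \<in> carrier K \<Longrightarrow> \<sigma> x = \<zero> \<longleftrightarrow> x = \<zero>"
  using \<sigma>_bij by (metis \<sigma>_zero bij_betw_def inj_onD zero_closed)

lemma F_closed [simp]: "a \<in> F \<Longrightarrow> a \<in> carrier K"
  using subfieldE(3)[OF subfield_F] by blast

lemma field_F: "field (K\<lparr>carrier := F\<rparr>)"
  by (rule subfield_iff(2)[OF subfield_F])

lemma inv_closed' [simp]: "\<lbrakk>x \<in> carrier K; x \<noteq> \<zero>\<rbrakk> \<Longrightarrow> inv x \<in> carrier K"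
  and inv_mult_cancel: "\<lbrakk>x \<in> carrier K; x \<noteq> \<zero>; y \<in> carrier K\<rbrakk> \<Longrightarrow> x \<otimes> (inv x \<otimes> y) = y"
  by (simp_all add: field_Units m_assoc[symmetric])

lemma eq_mult_inv_iff:
  assumes "x \<in> carrier K" "y \<in> carrier K" "z \<in> carrier K" "z \<noteq> \<zero>"
  shows "x = y \<otimes> inv z \<longleftrightarrow> x \<otimes> z = y"
  using assms by (auto simp: m_assoc field_Units)

text \<open>Clearing the denominators \<open>\<sigma> s\<close>, \<open>t\<close> and
  \<open>\<sigma> t\<close>, all nonzero, turns the excluded form of \<open>c\<close> into the
  equation that the elimination produces.\<close>

lemma zero_divisor_equation_iff:
  assumes "r \<in> carrier K" "s \<in> carrier K" "t \<in> carrier K" "s \<noteq> \<zero>" "t \<noteq> \<zero>"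
  shows "c = r [^] (2::nat) \<otimes> s \<otimes> inv (\<sigma> s) \<otimes> inv t \<otimes> inv (\<sigma> t)
    \<longleftrightarrow> c \<otimes> (t \<otimes> \<sigma> t) \<otimes> \<sigma> s = r \<otimes> r \<otimes> s"
  using assms by (simp add: eq_mult_inv_iff numeral_2_eq_2) (simp add: m_ac)

section \<open>Algebra structure and finite dimension\<close>

lemma module_D: "module (K\<lparr>carrier := F\<rparr>) D"
proof (rule moduleI)
  show "cring (K\<lparr>carrier := F\<rparr>)" using field_F by (rule fieldE)
  show "abelian_group D"
  proof (rule abelian_groupI)
    fix x assume "x \<in> carrier D"
    then show "\<exists>y\<in>carrier D. y \<oplus>\<^bsub>D\<^esub> x = \<zero>\<^bsub>D\<^esub>"
      by (intro bexI[of _ "(\<ominus> fst x, \<ominus> snd x)"]) (auto simp: l_neg)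
  qed (auto simp: a_ac)
qed (auto simp: l_distr r_distr m_assoc)

lemma mult_comm_D: "\<lbrakk>x \<in> carrier D; y \<in> carrier D\<rbrakk> \<Longrightarrow> x \<otimes>\<^bsub>D\<^esub> y = y \<otimes>\<^bsub>D\<^esub> x"
  by (auto simp: m_comm a_comm)

text \<open>Compatibility with scalars rests on \<sigma> fixing \<open>F\<close> pointwise: a scalar
  \<open>a\<close> from either factor ends up inside \<sigma> and comes out unchanged.\<close>

lemma nonassoc_algebra_D: "nonassoc_algebra (K\<lparr>carrier := F\<rparr>) D"
proof (intro nonassoc_algebra.intro module_D nonassoc_algebra_axioms.intro)
qed (auto simp: l_distr r_distr a_ac m_ac \<sigma>_fixes)

text \<open>If \<open>Us\<close> spans \<open>K\<close> over \<open>F\<close>, then the copies of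
  \<open>Us\<close> on the two coordinate axes span \<open>D\<close>, since each pair is the sum of
  its projections to the axes.\<close>

lemma finitely_spanned_D: "finitely_spanned (K\<lparr>carrier := F\<rparr>) D"
proof -
  interpret M: module "K\<lparr>carrier := F\<rparr>" D by (rule module_D)
  obtain n where n: "dimension n F (carrier K)"
    using finite_ext by (auto simp: finite_dimension_def)
  obtain Us where Us: "set Us \<subseteq> carrier K" "Span F Us = carrier K"
    using exists_base[OF subfield_F n] by blast
  define B where "B = (\<lambda>u. (u, \<zero>)) ` set Us \<union> (\<lambda>u. (\<zero>, u)) ` set Us"
  have B: "finite B" "B \<subseteq> carrier D" using Us(1) by (auto simp: B_def)
  let ?L = "lin_combs (K\<lparr>carrier := F\<rparr>) D B"
  \<comment> \<open>The list \<open>Vs\<close> is arbitrary with entries from \<open>Us\<close>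
    because the induction passes to tails, while \<open>B\<close> has to stay fixed.\<close>
  have "(combine Ks Vs, \<zero>) \<in> ?L \<and> (\<zero>, combine Ks Vs) \<in> ?L"
    if "set Ks \<subseteq> F" "set Vs \<subseteq> set Us" for Ks Vs
    using that
  proof (induction Ks Vs rule: combine.induct)
    case (1 k Ks u Vs)
    then have k: "k \<in> F" "u \<in> carrier K" "set Ks \<subseteq> carrier K" "set Vs \<subseteq> carrier K"
      using Us(1) by auto
    have "(u, \<zero>) \<in> B" "(\<zero>, u) \<in> B"
      using 1(3) by (auto simp: B_def)
    then have "(u, \<zero>) \<in> ?L" "(\<zero>, u) \<in> ?L"
      by (auto intro: M.in_lin_combs[OF B])
    then have "k \<odot>\<^bsub>D\<^esub> (u, \<zero>) \<in> ?L" "k \<odot>\<^bsub>D\<^esub> (\<zero>, u) \<in> ?L"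
      using M.lin_combs_smult[OF B, of k] k(1) by (simp_all del: D_simps)
    then have "k \<odot>\<^bsub>D\<^esub> (u, \<zero>) \<oplus>\<^bsub>D\<^esub> (combine Ks Vs, \<zero>) \<in> ?L"
      "k \<odot>\<^bsub>D\<^esub> (\<zero>, u) \<oplus>\<^bsub>D\<^esub> (\<zero>, combine Ks Vs) \<in> ?L"
      using 1 by (auto intro!: M.lin_combs_add[OF B] simp del: D_simps)
    then show ?case using k by simp
  qed (use M.zero_in_lin_combs[OF B] in simp_all)
  moreover have "\<exists>Ks. set Ks \<subseteq> F \<and> x = combine Ks Us" if "x \<in> carrier K" for x
    using that unfolding Us(2)[symmetric] Span_eq_combine_set[OF subfield_F Us(1)] by blast
  ultimately have axes: "(x, \<zero>) \<in> ?L" "(\<zero>, x) \<in> ?L" if "x \<in> carrier K" for x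
    using that by (metis order_refl)+
  have "z \<in> ?L" if z: "z \<in> carrier D" for z
    using M.lin_combs_add[OF B axes(1)[of "fst z"] axes(2)[of "snd z"]] z by (cases z) auto
  then show ?thesis
    using B by (auto simp: finitely_spanned_def lin_combs_def simp del: D_simps)
qed

section \<open>Zero divisors and the elimination of a coordinate\<close>

text \<open>The first coordinate of the second factor is the solution \<open>x\<close> of
  \<open>r \<otimes> s \<oplus> t \<otimes> x = \<zero>\<close>, so the second coordinate of the
  product vanishes by construction; \<open>eq\<close> makes the first one vanish. Allowing
  \<open>r\<close> and \<open>s\<close> to be zero lets the same computation describe the kernel in
  \<open>mult_surj_D\<close>.\<close>

lemma zero_divisor_D:
  assumes "r \<in> carrier K" "s \<in> carrier K" "t \<in> carrier K" "t \<noteq> \<zero>"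
    and eq: "c \<otimes> (t \<otimes> \<sigma> t) \<otimes> \<sigma> s = r \<otimes> r \<otimes> s"
  shows "(r, t) \<otimes>\<^bsub>D\<^esub> (\<ominus> (inv t \<otimes> (r \<otimes> s)), s) = \<zero>\<^bsub>D\<^esub>"
proof -
  let ?x = "\<ominus> (inv t \<otimes> (r \<otimes> s))"
  have x: "?x \<in> carrier K" and tx: "t \<otimes> ?x = \<ominus> (r \<otimes> s)"
    using assms by (simp_all add: r_minus inv_mult_cancel)
  \<comment> \<open>After multiplication by the nonzero \<open>t\<close>, the unknown occurs only in
    \<open>t \<otimes> ?x\<close>, which is known without inverses.\<close>
  have "t \<otimes> (r \<otimes> ?x \<oplus> c \<otimes> \<sigma> (t \<otimes> s)) = r \<otimes> (t \<otimes> ?x) \<oplus> c \<otimes> (t \<otimes> \<sigma> t) \<otimes> \<sigma> s"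
    using assms(1-4) x by (simp add: r_distr m_ac)
  also have "\<dots> = \<zero>"
    unfolding tx eq using assms(1-4) by (simp add: r_minus m_assoc l_neg)
  finally have "r \<otimes> ?x \<oplus> c \<otimes> \<sigma> (t \<otimes> s) = \<zero>"
    using assms(1-4) x integral[of t] by auto
  then show ?thesis using tx assms(1-3) by (simp add: r_neg)
qed

text \<open>For \<open>v = \<zero>\<close> the product is coordinatewise scaling by the nonzero
  \<open>u\<close>. For \<open>v \<noteq> \<zero>\<close>, eliminating \<open>x\<close> would yield
  the excluded equation unless \<open>y = \<zero>\<close>, and then \<open>x = \<zero>\<close> as
  well.\<close>

lemma no_zero_divisor_D:
  assumes excl: "\<And>r s t. \<lbrakk>r \<in> carrier K - {\<zero>}; s \<in> carrier K - {\<zero>}; t \<in> carrier K - {\<zero>}\<rbrakk> \<Longrightarrow>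
      c \<otimes> (t \<otimes> \<sigma> t) \<otimes> \<sigma> s \<noteq> r \<otimes> r \<otimes> s"
    and a: "a \<in> carrier D" "a \<noteq> \<zero>\<^bsub>D\<^esub>" and b: "b \<in> carrier D" and ab: "a \<otimes>\<^bsub>D\<^esub> b = \<zero>\<^bsub>D\<^esub>"
  shows "b = \<zero>\<^bsub>D\<^esub>"
proof -
  obtain u v x y where ab_eq: "a = (u, v)" "b = (x, y)" by (metis surj_pair)
  have [simp]: "u \<in> carrier K" "v \<in> carrier K" "x \<in> carrier K" "y \<in> carrier K"
    using a b ab_eq by auto
  have e1: "u \<otimes> x \<oplus> c \<otimes> \<sigma> (v \<otimes> y) = \<zero>" and e2: "u \<otimes> y \<oplus> v \<otimes> x = \<zero>"
    using ab ab_eq by auto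
  show ?thesis
  proof (cases "v = \<zero>")
    case True
    then have "u \<noteq> \<zero>" "u \<otimes> x = \<zero>" "u \<otimes> y = \<zero>" using a ab_eq e1 e2 by auto
    then show ?thesis using integral[of u] ab_eq by auto
  next
    case v: False
    \<comment> \<open>The multiple of \<open>e1\<close> by \<open>v\<close> and that of
      \<open>e2\<close> by \<open>u\<close> are both zero and share the term
      \<open>u \<otimes> (v \<otimes> x)\<close>; cancelling it removes \<open>x\<close>.\<close>
    have "c \<otimes> (v \<otimes> \<sigma> v) \<otimes> \<sigma> y \<oplus> u \<otimes> (v \<otimes> x) = v \<otimes> (u \<otimes> x \<oplus> c \<otimes> \<sigma> (v \<otimes> y))"
      by (simp add: r_distr m_ac a_ac)
    also have "\<dots> = u \<otimes> (u \<otimes> y \<oplus> v \<otimes> x)"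
      unfolding e1 e2 by simp
    also have "\<dots> = u \<otimes> u \<otimes> y \<oplus> u \<otimes> (v \<otimes> x)"
      by (simp add: r_distr m_assoc)
    finally have eq: "c \<otimes> (v \<otimes> \<sigma> v) \<otimes> \<sigma> y = u \<otimes> u \<otimes> y"
      by simp
    have "y = \<zero>"
    proof (rule ccontr)
      assume y: "y \<noteq> \<zero>"
      \<comment> \<open>With \<open>u = \<zero>\<close> the right side of \<open>eq\<close>
        vanishes, while its left side is a product of nonzero factors. Hence all three entries of
        \<open>(u, y, v)\<close> are nonzero and \<open>excl\<close> applies.\<close>
      then have "u \<noteq> \<zero>" using eq v by (auto simp: integral_iff)
      then show False using excl[of u y v] eq v y by simp
    qed
    moreover from this have "x = \<zero>" using e2 v integral[of v x] by auto
    ultimately show ?thesis by (simp add: ab_eq)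
  qed
qed

section \<open>Bijectivity of multiplication\<close>

text \<open>For \<open>v = \<zero>\<close> one divides by \<open>u\<close>. Otherwise the second
  coordinate gives \<open>v \<otimes> x = q \<ominus> u \<otimes> y\<close>, and substitution into
  \<open>v\<close> times the first leaves
  \<open>f y = v \<otimes> p \<ominus> u \<otimes> q\<close>. This is solvable because
  \<open>f\<close> is linear over \<open>F\<close> with trivial kernel and \<open>K\<close> is
  finite over \<open>F\<close>.\<close>

lemma mult_surj_D:
  assumes nzd: "\<And>b. \<lbrakk>b \<in> carrier D; a \<otimes>\<^bsub>D\<^esub> b = \<zero>\<^bsub>D\<^esub>\<rbrakk> \<Longrightarrow> b = \<zero>\<^bsub>D\<^esub>"
    and a: "a \<in> carrier D" "a \<noteq> \<zero>\<^bsub>D\<^esub>" and z: "z \<in> carrier D"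
  shows "\<exists>b\<in>carrier D. a \<otimes>\<^bsub>D\<^esub> b = z"
proof -
  obtain u v p q where eqs: "a = (u, v)" "z = (p, q)" by (metis surj_pair)
  have [simp]: "u \<in> carrier K" "v \<in> carrier K" "p \<in> carrier K" "q \<in> carrier K"
    using a z eqs by auto
  show ?thesis
  proof (cases "v = \<zero>")
    case True
    then have "u \<noteq> \<zero>" using a eqs by auto
    then show ?thesis
      by (intro bexI[of _ "(inv u \<otimes> p, inv u \<otimes> q)"]) (auto simp: eqs True inv_mult_cancel)
  next
    case v: False
    define f where "f y = c \<otimes> (v \<otimes> \<sigma> v) \<otimes> \<sigma> y \<ominus> u \<otimes> u \<otimes> y" for y
    have "f ` carrier K = carrier K"
    proof (rule linear_inj_imp_surj[OF subfield_F finite_ext])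
      show "f (x \<oplus> y) = f x \<oplus> f y" if "x \<in> carrier K" "y \<in> carrier K" for x y
        using that by (simp add: f_def r_distr minus_eq minus_add a_ac)
      show "f (k \<otimes> x) = k \<otimes> f x" if "k \<in> F" "x \<in> carrier K" for k x
        using that by (simp add: f_def \<sigma>_fixes minus_eq r_distr r_minus m_ac)
      \<comment> \<open>A kernel element \<open>y\<close> is completed by
        \<open>zero_divisor_D\<close> to a pair annihilated by \<open>a\<close>; by
        \<open>nzd\<close> this pair is zero, and \<open>y\<close> is its second coordinate.\<close>
      show "y = \<zero>" if y: "y \<in> carrier K" "f y = \<zero>" for y
      proof -
        have "c \<otimes> (v \<otimes> \<sigma> v) \<otimes> \<sigma> y = u \<otimes> u \<otimes> y"
          using y by (simp add: f_def)
        then have "a \<otimes>\<^bsub>D\<^esub> (\<ominus> (inv v \<otimes> (u \<otimes> y)), y) = \<zero>\<^bsub>D\<^esub>"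
          unfolding eqs(1) by (intro zero_divisor_D v y(1)) simp_all
        moreover have "(\<ominus> (inv v \<otimes> (u \<otimes> y)), y) \<in> carrier D"
          using v y(1) by simp
        ultimately have "(\<ominus> (inv v \<otimes> (u \<otimes> y)), y) = \<zero>\<^bsub>D\<^esub>"
          by (rule nzd[rotated])
        then show ?thesis by simp
      qed
    qed (simp add: f_def)
    moreover have "v \<otimes> p \<ominus> u \<otimes> q \<in> carrier K" by simp
    ultimately obtain y where y [simp]: "y \<in> carrier K" and fy: "f y = v \<otimes> p \<ominus> u \<otimes> q"
      by (metis imageE)
    \<comment> \<open>The second coordinate of the product forces this value; the first is then
      verified after multiplication by \<open>v\<close>, which is cancelled at the end.\<close>
    define x where "x = inv v \<otimes> (q \<ominus> u \<otimes> y)"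
    have x [simp]: "x \<in> carrier K" and vx: "v \<otimes> x = q \<ominus> u \<otimes> y"
      using v by (simp_all add: x_def inv_mult_cancel)
    have "v \<otimes> (u \<otimes> x \<oplus> c \<otimes> \<sigma> (v \<otimes> y)) = u \<otimes> (v \<otimes> x) \<oplus> c \<otimes> (v \<otimes> \<sigma> v) \<otimes> \<sigma> y"
      by (simp add: r_distr m_ac)
    also have "\<dots> = u \<otimes> q \<oplus> f y"
      unfolding vx f_def by (simp add: minus_eq r_distr r_minus m_assoc a_ac)
    also have "\<dots> = v \<otimes> p"
      unfolding fy by (simp add: minus_eq a_lcomm[of "u \<otimes> q"] r_neg)
    finally have "u \<otimes> x \<oplus> c \<otimes> \<sigma> (v \<otimes> y) = p"
      using m_lcancel[OF v, of "u \<otimes> x \<oplus> c \<otimes> \<sigma> (v \<otimes> y)" p] by simp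
    moreover have "u \<otimes> y \<oplus> v \<otimes> x = q"
      unfolding vx by (simp add: minus_eq a_lcomm[of "u \<otimes> y"] r_neg)
    ultimately show ?thesis
      by (intro bexI[of _ "(x, y)"]) (simp_all add: eqs)
  qed
qed

text \<open>Distributivity turns \<open>a \<otimes> x = a \<otimes> y\<close> into the vanishing of
  \<open>a\<close> times the difference, so \<open>nzd\<close> yields injectivity; surjectivity is
  \<open>mult_surj_D\<close>.\<close>

lemma mult_bij_D:
  assumes nzd: "\<And>b. \<lbrakk>b \<in> carrier D; a \<otimes>\<^bsub>D\<^esub> b = \<zero>\<^bsub>D\<^esub>\<rbrakk> \<Longrightarrow> b = \<zero>\<^bsub>D\<^esub>"
    and a: "a \<in> carrier D" "a \<noteq> \<zero>\<^bsub>D\<^esub>"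
  shows "bij_betw (\<lambda>x. a \<otimes>\<^bsub>D\<^esub> x) (carrier D) (carrier D)"
proof -
  interpret A: nonassoc_algebra "K\<lparr>carrier := F\<rparr>" D by (rule nonassoc_algebra_D)
  have "x = y" if xy: "x \<in> carrier D" "y \<in> carrier D" and eq: "a \<otimes>\<^bsub>D\<^esub> x = a \<otimes>\<^bsub>D\<^esub> y" for x y
  proof -
    have d: "x \<ominus>\<^bsub>D\<^esub> y \<in> carrier D" using xy by (rule A.M.minus_closed)
    have diff: "x = (x \<ominus>\<^bsub>D\<^esub> y) \<oplus>\<^bsub>D\<^esub> y"
      using xy by (simp add: A.M.minus_eq A.M.a_assoc A.M.l_neg del: D_simps)
    then have "a \<otimes>\<^bsub>D\<^esub> (x \<ominus>\<^bsub>D\<^esub> y) \<oplus>\<^bsub>D\<^esub> a \<otimes>\<^bsub>D\<^esub> y = a \<otimes>\<^bsub>D\<^esub> y"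
      using A.mult_r_distr[OF d xy(2) a(1)] eq by simp
    then have "a \<otimes>\<^bsub>D\<^esub> (x \<ominus>\<^bsub>D\<^esub> y) = \<zero>\<^bsub>D\<^esub>"
      using A.M.add.l_cancel_one A.mult_closed[OF a(1) d] A.mult_closed[OF a(1) xy(2)]
        A.M.add.r_cancel_one by metis
    then have "x \<ominus>\<^bsub>D\<^esub> y = \<zero>\<^bsub>D\<^esub>" using nzd d by blast
    then show "x = y" using diff xy by (metis A.M.l_zero)
  qed
  then have "inj_on (\<lambda>x. a \<otimes>\<^bsub>D\<^esub> x) (carrier D)" by (rule inj_onI)
  moreover have "(\<lambda>x. a \<otimes>\<^bsub>D\<^esub> x) ` carrier D = carrier D"
  proof
    show "(\<lambda>x. a \<otimes>\<^bsub>D\<^esub> x) ` carrier D \<subseteq> carrier D"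
      using A.mult_closed[OF a(1)] by blast
    show "carrier D \<subseteq> (\<lambda>x. a \<otimes>\<^bsub>D\<^esub> x) ` carrier D"
      using mult_surj_D[OF nzd a] by blast
  qed
  ultimately show ?thesis by (simp add: bij_betw_def)
qed

lemma division_algebra_D:
  assumes nzd: "\<And>a b. \<lbrakk>a \<in> carrier D; a \<noteq> \<zero>\<^bsub>D\<^esub>; b \<in> carrier D; a \<otimes>\<^bsub>D\<^esub> b = \<zero>\<^bsub>D\<^esub>\<rbrakk> \<Longrightarrow> b = \<zero>\<^bsub>D\<^esub>"
  shows "division_algebra (K\<lparr>carrier := F\<rparr>) D"
proof (intro division_algebra.intro division_algebra_axioms.intro field_F nonassoc_algebra_D
    finitely_spanned_D)
  fix a assume a: "a \<in> carrier D" "a \<noteq> \<zero>\<^bsub>D\<^esub>"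
  show bij: "bij_betw (\<lambda>x. a \<otimes>\<^bsub>D\<^esub> x) (carrier D) (carrier D)"
    by (rule mult_bij_D[OF nzd[OF a] a])
  show "bij_betw (\<lambda>x. x \<otimes>\<^bsub>D\<^esub> a) (carrier D) (carrier D)"
    \<comment> \<open>By commutativity, left and right multiplication by \<open>a\<close> agree on
      the carrier.\<close>
    using bij by (rule bij_betw_cong[THEN iffD1, rotated]) (rule mult_comm_D[OF a(1)])
qed

end

section \<open>Division property versus the excluded form of c\<close>

theorem theorem2p3:
  fixes K :: "('a, 'm) ring_scheme" and F :: "'a set" and \<sigma> :: "'a \<Rightarrow> 'a" and c :: 'a
  assumes "field K"
    and "subfield F K"
    and "ring.finite_dimension K F (carrier K)"
    and "\<sigma> \<in> field_auts K F"
    and "\<exists>x\<in>carrier K. \<sigma> x \<noteq> x"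
    and "c \<in> carrier K - {\<zero>\<^bsub>K\<^esub>}"
  shows "division_algebra (K\<lparr>carrier := F\<rparr>) (D_algebra K \<sigma> c) \<longleftrightarrow>
    (\<forall>r\<in>carrier K - {\<zero>\<^bsub>K\<^esub>}. \<forall>s\<in>carrier K - {\<zero>\<^bsub>K\<^esub>}. \<forall>t\<in>carrier K - {\<zero>\<^bsub>K\<^esub>}.
       c \<noteq> r [^]\<^bsub>K\<^esub> (2::nat) \<otimes>\<^bsub>K\<^esub> s \<otimes>\<^bsub>K\<^esub> inv\<^bsub>K\<^esub> (\<sigma> s) \<otimes>\<^bsub>K\<^esub> inv\<^bsub>K\<^esub> t \<otimes>\<^bsub>K\<^esub> inv\<^bsub>K\<^esub> (\<sigma> t))"
    (is "?div \<longleftrightarrow> ?excl")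
proof -
  interpret twisted_double K F \<sigma> c
    using assms by (intro twisted_double.intro twisted_double_axioms.intro) auto
  show ?thesis
  proof
    assume ?div
    then interpret A: division_algebra "K\<lparr>carrier := F\<rparr>" D .
    show ?excl
    proof (intro ballI notI)
      fix r s t
      assume r: "r \<in> carrier K - {\<zero>\<^bsub>K\<^esub>}" and s: "s \<in> carrier K - {\<zero>\<^bsub>K\<^esub>}"
        and t: "t \<in> carrier K - {\<zero>\<^bsub>K\<^esub>}"
        and "c = r [^]\<^bsub>K\<^esub> (2::nat) \<otimes>\<^bsub>K\<^esub> s \<otimes>\<^bsub>K\<^esub> inv\<^bsub>K\<^esub> (\<sigma> s) \<otimes>\<^bsub>K\<^esub> inv\<^bsub>K\<^esub> t \<otimes>\<^bsub>K\<^esub> inv\<^bsub>K\<^esub> (\<sigma> t)"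
      then have eq: "c \<otimes>\<^bsub>K\<^esub> (t \<otimes>\<^bsub>K\<^esub> \<sigma> t) \<otimes>\<^bsub>K\<^esub> \<sigma> s = r \<otimes>\<^bsub>K\<^esub> r \<otimes>\<^bsub>K\<^esub> s"
        using zero_divisor_equation_iff[of r s t] by simp
      let ?b = "(\<ominus>\<^bsub>K\<^esub> (inv\<^bsub>K\<^esub> t \<otimes>\<^bsub>K\<^esub> (r \<otimes>\<^bsub>K\<^esub> s)), s)"
      \<comment> \<open>An excluded triple makes \<open>(r, t)\<close> annihilate \<open>?b\<close>.
        Injectivity of multiplication by \<open>(r, t)\<close> would force \<open>?b\<close> to be
        zero, but its second coordinate is \<open>s\<close>.\<close>
      have "(r, t) \<otimes>\<^bsub>D\<^esub> ?b = (r, t) \<otimes>\<^bsub>D\<^esub> \<zero>\<^bsub>D\<^esub>"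
        using zero_divisor_D[of r s t] eq r s t by simp
      moreover have "inj_on (\<lambda>x. (r, t) \<otimes>\<^bsub>D\<^esub> x) (carrier D)"
        using A.left_mult_bij[of "(r, t)"] r t by (simp add: bij_betw_def)
      ultimately have "?b = \<zero>\<^bsub>D\<^esub>"
        using r s t by (elim inj_onD) simp_all
      then show False using s by simp
    qed
  next
    assume ?excl
    then have "c \<otimes>\<^bsub>K\<^esub> (t \<otimes>\<^bsub>K\<^esub> \<sigma> t) \<otimes>\<^bsub>K\<^esub> \<sigma> s \<noteq> r \<otimes>\<^bsub>K\<^esub> r \<otimes>\<^bsub>K\<^esub> s"
      if "r \<in> carrier K - {\<zero>\<^bsub>K\<^esub>}" "s \<in> carrier K - {\<zero>\<^bsub>K\<^esub>}" "t \<in> carrier K - {\<zero>\<^bsub>K\<^esub>}" for r s t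
      using zero_divisor_equation_iff[of r s t] that by auto
    then show ?div
      by (rule division_algebra_D[OF no_zero_divisor_D])
  qed
qed

end
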